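(* Let $x_n\in\mathbb{T}$, $n\in\mathbb{N}$, be such that $x_n\to e$. Let $\{X_{n,k}:n\in\mathbb{N},\ k=1,\ldots,K_n\}$ be an array of random elements in the torus $\mathbb{T}$ such that for each $n$ the elements $X_{n,1},\ldots,X_{n,K_n}$ are independent and identically distributed, $K_n\to\infty$, and each $X_{n,k}$ takes the value $x_n$ and its group inverse $x_n^{-1}$ with probability $\frac12$ each, i.e. has distribution $\frac12(\delta_{x_n}+\delta_{x_n^{-1}})$. Then the array is infinitesimal. If $b$ is a nonnegative real number, then the distribution of $\sum_{k=1}^{K_n}X_{n,k}$ converges weakly to $\gamma_{\psi_b}$ as $n\to\infty$ if and only if $K_n(\arg x_n)^2\to b$. Moreover, the distribution of $\sum_{k=1}^{K_n}X_{n,k}$ converges weakly to $\omega_{\mathbb{T}}$ as $n\to\infty$ if and only if $K_n(\arg x_n)^2\to\infty$.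
   Context: $\mathbb{T}=\{e^{ix}:-\pi\le x<\pi\}$ is the circle group under multiplication of complex numbers, with identity $e=1$; $\sum_{k=1}^{K_n}X_{n,k}$ denotes the group operation applied to $X_{n,1},\ldots,X_{n,K_n}$, i.e. the product of these complex numbers. $\mathbb{N}$ is the set of positive integers. $\delta_x$ is the Dirac measure at $x$. $\arg:\mathbb{T}\to[-\pi,\pi)$ is given by $\arg(e^{ix})=x$ for $-\pi\le x<\pi$. Infinitesimal: $\lim_{n\to\infty}\max_{1\le k\le K_n}\mathrm{P}(X_{n,k}\in\mathbb{T}\setminus U)=0$ for every Borel set $U$ containing an open set that contains $e$. $\gamma_{\psi_b}$ is the (existing, unique) probability measure on $\mathbb{T}$ with $\int_{\mathbb{T}}y^\ell\,d\gamma_{\psi_b}(y)=e^{-b\ell^2/2}$ for all $\ell\in\mathbb{Z}$. $\omega_{\mathbb{T}}$ is the normalized Haar measure on $\mathbb{T}$. *)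

theory Defs
  imports "HOL-Probability.Probability"
begin

text \<open>The circle group is the set of complex numbers of modulus one under complex
  multiplication, with its Borel sets; measures on it have the circle as their space.\<close>

definition circle :: "complex set" where
  "circle = sphere 0 1"

definition circle_borel :: "complex measure" where
  "circle_borel = restrict_space borel circle"

text \<open>The values lie in \<open>[-pi, pi)\<close>, unlike those of \<^const>\<open>Arg\<close>, which lie in
  \<open>(-pi, pi]\<close>.\<close>

definition circle_arg :: "complex \<Rightarrow> real" where
  "circle_arg z = (THE t. - pi \<le> t \<and> t < pi \<and> cis t = z)"

definition circle_weak_conv :: "(nat \<Rightarrow> complex measure) \<Rightarrow> complex measure \<Rightarrow> bool" where
  "circle_weak_conv \<mu> \<nu> \<longleftrightarrow>
    (\<forall>f :: complex \<Rightarrow> real. continuous_on circle f \<longrightarrow> bounded (f ` circle) \<longrightarrow>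
      (\<lambda>n. \<integral>y. f y \<partial>\<mu> n) \<longlonglongrightarrow> (\<integral>y. f y \<partial>\<nu>))"

definition circle_prob :: "complex measure \<Rightarrow> bool" where
  "circle_prob \<mu> \<longleftrightarrow> prob_space \<mu> \<and> sets \<mu> = sets circle_borel"

text \<open>Meaningful for \<open>b \<ge> 0\<close>, where exactly one such probability measure exists.\<close>

definition circle_gauss :: "real \<Rightarrow> complex measure" where
  "circle_gauss b = (THE \<mu>. circle_prob \<mu> \<and>
    (\<forall>l::int. (\<integral>y. y powi l \<partial>\<mu>) = complex_of_real (exp (- b * (real_of_int l)\<^sup>2 / 2))))"

definition circle_haar :: "complex measure" where
  "circle_haar = (THE \<mu>. circle_prob \<mu> \<and>
    (\<forall>z\<in>circle. distr \<mu> circle_borel (\<lambda>y. z * y) = \<mu>))"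

text \<open>Row \<open>n\<close> consists of \<open>X n 1, \<dots>, X n (K n)\<close>, defined on its own probability
  space \<open>M n\<close>.\<close>

definition circle_infinitesimal ::
    "(nat \<Rightarrow> 'a measure) \<Rightarrow> (nat \<Rightarrow> nat) \<Rightarrow> (nat \<Rightarrow> nat \<Rightarrow> 'a \<Rightarrow> complex) \<Rightarrow> bool" where
  "circle_infinitesimal M K X \<longleftrightarrow>
    (\<forall>U\<in>sets circle_borel.
      (\<exists>V. openin (top_of_set circle) V \<and> 1 \<in> V \<and> V \<subseteq> U) \<longrightarrow>
      (\<lambda>n. MAX k\<in>{1..K n}. measure (M n) {\<omega> \<in> space (M n). X n k \<omega> \<in> circle - U})
        \<longlonglongrightarrow> 0)"

end

theory Submission
  imports Defs "HOL-Real_Asymp.Real_Asymp"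
begin

text \<open>Weak convergence on the circle is convergence of all Fourier coefficients, since
  trigonometric polynomials are uniformly dense in the continuous functions. By independence the
  \<open>l\<close>-th coefficient of the row product is \<open>cos (l a) ^ K\<close> with \<open>a = arg x\<close>, and it equals
  \<open>exp (K a\<^sup>2 \<cdot> l\<^sup>2 g (l a))\<close> with \<open>g t = ln (cos t) / t\<^sup>2 \<longlongrightarrow> - 1 / 2\<close> as
  \<open>t \<longlongrightarrow> 0\<close>. So the limit of \<open>K a\<^sup>2\<close> decides the limit of every coefficient, and the
  coefficient \<open>l = 1\<close> alone recovers it. The Gauss measure is the image of a normal law and
  the Haar measure that of the uniform law on \<open>[-pi, pi]\<close> under \<open>cis\<close>.\<close>

section \<open>The circle and integration of continuous functions over it\<close>

lemma compact_circle: "compact circle"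
  by (simp add: circle_def)

lemma circle_nonzero: "z \<in> circle \<Longrightarrow> z \<noteq> 0"
  by (auto simp: circle_def)

lemma cis_in_circle: "cis t \<in> circle"
  by (simp add: circle_def)

lemma mult_in_circle: "z \<in> circle \<Longrightarrow> w \<in> circle \<Longrightarrow> z * w \<in> circle"
  by (simp add: circle_def norm_mult)

lemma inverse_in_circle: "z \<in> circle \<Longrightarrow> inverse z \<in> circle"
  by (simp add: circle_def norm_inverse)

lemma space_circle_borel: "space circle_borel = circle"
  by (simp add: circle_borel_def space_restrict_space)

lemma space_circle_prob: "circle_prob \<mu> \<Longrightarrow> space \<mu> = circle"
  unfolding circle_prob_def by (metis sets_eq_imp_space_eq space_circle_borel)

lemma continuous_on_circle_powi: "continuous_on circle (\<lambda>z. z powi l)"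
  by (intro continuous_intros) (auto dest: circle_nonzero)

lemma borel_measurable_circle:
  fixes f :: "complex \<Rightarrow> 'b::topological_space"
  assumes "circle_prob \<mu>" "continuous_on circle f"
  shows "f \<in> borel_measurable \<mu>"
  using borel_measurable_continuous_on_restrict[OF assms(2)] assms(1)
  unfolding circle_prob_def circle_borel_def by (metis measurable_cong_sets)

text \<open>Compactness bounds a continuous function, and bounded measurable functions are
  integrable against a probability measure.\<close>

lemma integrable_circle:
  fixes f :: "complex \<Rightarrow> 'b::{banach, second_countable_topology}"
  assumes "circle_prob \<mu>" "continuous_on circle f"
  shows "integrable \<mu> f"
proof -
  interpret prob_space \<mu> using assms(1) by (simp add: circle_prob_def)
  obtain B where "\<And>z. z \<in> circle \<Longrightarrow> norm (f z) \<le> B"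
    using compact_imp_bounded[OF compact_continuous_image[OF assms(2) compact_circle]]
    by (auto simp: bounded_iff)
  then show ?thesis
    using borel_measurable_circle[OF assms] space_circle_prob[OF assms(1)]
    by (intro integrable_const_bound[of _ B]) (auto intro!: AE_I2)
qed

text \<open>Total mass one lets a uniform approximation on the circle carry over to integrals with
  the same error for every measure.\<close>

lemma integral_circle_close:
  fixes f g :: "complex \<Rightarrow> real"
  assumes "circle_prob \<mu>" "continuous_on circle f" "continuous_on circle g"
    and "\<And>z. z \<in> circle \<Longrightarrow> \<bar>f z - g z\<bar> \<le> e"
  shows "\<bar>(\<integral>z. f z \<partial>\<mu>) - (\<integral>z. g z \<partial>\<mu>)\<bar> \<le> e"
proof -
  interpret prob_space \<mu> using assms(1) by (simp add: circle_prob_def)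
  have int: "integrable \<mu> f" "integrable \<mu> g"
    using assms by (auto intro: integrable_circle)
  have "\<bar>(\<integral>z. f z \<partial>\<mu>) - (\<integral>z. g z \<partial>\<mu>)\<bar> = \<bar>\<integral>z. f z - g z \<partial>\<mu>\<bar>"
    using int by simp
  also have "\<dots> \<le> (\<integral>z. \<bar>f z - g z\<bar> \<partial>\<mu>)"
    by (rule integral_abs_bound)
  also have "\<dots> \<le> e"
    using int assms(4) space_circle_prob[OF assms(1)]
    by (intro integral_le_const) (auto intro!: AE_I2)
  finally show ?thesis .
qed

section \<open>Trigonometric polynomials\<close>

text \<open>The rule \<open>cong\<close> is needed because \<open>0 powi l\<close> breaks the exponent laws off the
  circle.\<close>

inductive trig_poly :: "(complex \<Rightarrow> complex) \<Rightarrow> bool" where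
  monomial: "trig_poly (\<lambda>z. c * z powi l)"
| add: "trig_poly p \<Longrightarrow> trig_poly q \<Longrightarrow> trig_poly (\<lambda>z. p z + q z)"
| cong: "trig_poly p \<Longrightarrow> (\<And>z. z \<in> circle \<Longrightarrow> q z = p z) \<Longrightarrow> trig_poly q"

lemma continuous_on_trig_poly: "trig_poly p \<Longrightarrow> continuous_on circle p"
proof (induction rule: trig_poly.induct)
  case (monomial c l)
  then show ?case by (intro continuous_on_mult continuous_on_const continuous_on_circle_powi)
next
  case (cong p q)
  then show ?case using continuous_on_cong by blast
qed (rule continuous_on_add)

text \<open>Products are handled in two inductions, one per factor. Here exponents add, which needs
  a nonzero base and hence the rule \<open>cong\<close>.\<close>

lemma trig_poly_mult_monomial: "trig_poly p \<Longrightarrow> trig_poly (\<lambda>z. p z * (c * z powi l))"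
proof (induction rule: trig_poly.induct)
  case (monomial d k)
  show ?case
    by (rule trig_poly.cong[OF trig_poly.monomial[of "d * c" "k + l"]])
      (simp add: circle_nonzero power_int_add)
next
  case (add p q)
  show ?case
    by (rule trig_poly.cong[OF trig_poly.add[OF add.IH]]) (simp add: algebra_simps)
next
  case (cong p q)
  show ?case
    by (rule trig_poly.cong[OF cong.IH]) (simp add: cong.hyps)
qed

lemma trig_poly_mult:
  assumes "trig_poly p" "trig_poly q"
  shows "trig_poly (\<lambda>z. p z * q z)"
  using assms(2)
proof (induction rule: trig_poly.induct)
  case (monomial c l)
  then show ?case by (rule trig_poly_mult_monomial[OF assms(1)])
next
  case (add q r)
  show ?case
    by (rule trig_poly.cong[OF trig_poly.add[OF add.IH]]) (simp add: algebra_simps)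
next
  case (cong q r)
  show ?case
    by (rule trig_poly.cong[OF cong.IH]) (simp add: cong.hyps)
qed

text \<open>Real polynomials are built from linear functionals and constants by sums and products,
  so only linear functionals need work. On the circle the conjugate of \<open>z\<close> is
  \<open>z powi (-1)\<close>.\<close>

lemma trig_poly_of_real_polynomial:
  "real_polynomial_function g \<Longrightarrow> trig_poly (\<lambda>z. of_real (g z))"
proof (induction rule: real_polynomial_function.induct)
  case (linear f)
  interpret f: bounded_linear f by fact
  \<comment> \<open>The coefficients come from Re z = (z + 1/z) / 2 and Im z = (z - 1/z) / (2 i),
    inserted into f z = Re z * f 1 + Im z * f i.\<close>
  let ?a = "(of_real (f 1) - \<i> * of_real (f \<i>)) / 2"
  let ?b = "(of_real (f 1) + \<i> * of_real (f \<i>)) / 2"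
  have "of_real (f z) = ?a * z powi 1 + ?b * z powi (-1)" if z: "z \<in> circle" for z
  proof -
    have "f z = f (Re z *\<^sub>R 1 + Im z *\<^sub>R \<i>)"
      by (rule arg_cong[of _ _ f]) (simp add: complex_eq_iff)
    also have "\<dots> = Re z * f 1 + Im z * f \<i>"
      by (simp only: f.add f.scaleR real_scaleR_def)
    finally have f: "f z = Re z * f 1 + Im z * f \<i>" .
    have "(Re z)\<^sup>2 + (Im z)\<^sup>2 = 1"
      using z by (simp add: circle_def cmod_def)
    then have "inverse z = cnj z"
      by (simp add: complex_eq_iff)
    then have inv: "z powi (-1) = cnj z"
      by (simp add: power_int_minus)
    show ?thesis
      unfolding f inv power_int_1_right by (simp add: complex_eq_iff field_simps)
  qed
  then show ?case
    by (rule trig_poly.cong[OF trig_poly.add[OF trig_poly.monomial trig_poly.monomial]])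
next
  case (const c)
  show ?case using trig_poly.monomial[of "of_real c" 0] by simp
qed (auto dest: trig_poly.add trig_poly_mult)

section \<open>Weak convergence through Fourier coefficients\<close>

text \<open>Linearity of the integral extends convergence from monomials. The \<mu> n are
  probability measures only eventually, so integrals are split and exchanged for large n.\<close>

lemma tendsto_integral_trig_poly:
  assumes \<mu>: "\<forall>\<^sub>F n in sequentially. circle_prob (\<mu> n)" and \<nu>: "circle_prob \<nu>"
    and coeff: "\<And>l::int. (\<lambda>n. \<integral>y. y powi l \<partial>\<mu> n) \<longlonglongrightarrow> (\<integral>y. y powi l \<partial>\<nu>)"
    and p: "trig_poly p"
  shows "(\<lambda>n. \<integral>y. p y \<partial>\<mu> n) \<longlonglongrightarrow> (\<integral>y. p y \<partial>\<nu>)"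
  using p
proof (induction rule: trig_poly.induct)
  case (monomial c l)
  then show ?case by (simp add: tendsto_mult_left coeff)
next
  case (add p q)
  have int: "integrable \<kappa> p" "integrable \<kappa> q" if "circle_prob \<kappa>" for \<kappa>
    using that add.hyps by (auto intro: integrable_circle continuous_on_trig_poly)
  have "\<forall>\<^sub>F n in sequentially.
      (\<integral>y. p y \<partial>\<mu> n) + (\<integral>y. q y \<partial>\<mu> n) = (\<integral>y. p y + q y \<partial>\<mu> n)"
    using \<mu> by eventually_elim (simp add: int)
  from Lim_transform_eventually[OF tendsto_add[OF add.IH] this]
  show ?case by (simp add: int \<nu>)
next
  case (cong p q)
  have eq: "(\<integral>y. p y \<partial>\<kappa>) = (\<integral>y. q y \<partial>\<kappa>)" if "circle_prob \<kappa>" for \<kappa>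
    using cong.hyps(2) space_circle_prob[OF that] by (intro Bochner_Integration.integral_cong) auto
  have "\<forall>\<^sub>F n in sequentially. (\<integral>y. p y \<partial>\<mu> n) = (\<integral>y. q y \<partial>\<mu> n)"
    using \<mu> by eventually_elim (simp add: eq)
  from Lim_transform_eventually[OF cong.IH this]
  show ?case by (simp add: eq[OF \<nu>])
qed

text \<open>Forwards, the real and imaginary parts of a monomial are bounded continuous test
  functions. Backwards, Stone-Weierstrass approximates a test function uniformly by a real
  polynomial, which is a trigonometric polynomial on the circle.\<close>

lemma circle_weak_conv_iff_coeff:
  assumes \<mu>: "\<forall>\<^sub>F n in sequentially. circle_prob (\<mu> n)" and \<nu>: "circle_prob \<nu>"
  shows "circle_weak_conv \<mu> \<nu> \<longleftrightarrow>
    (\<forall>l::int. (\<lambda>n. \<integral>y. y powi l \<partial>\<mu> n) \<longlonglongrightarrow> (\<integral>y. y powi l \<partial>\<nu>))"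
proof (intro iffI allI)
  fix l :: int
  assume w: "circle_weak_conv \<mu> \<nu>"
  have int: "integrable \<kappa> (\<lambda>y. y powi l)" if "circle_prob \<kappa>" for \<kappa>
    using that by (intro integrable_circle continuous_on_circle_powi)
  have weak: "(\<lambda>n. \<integral>y. f y \<partial>\<mu> n) \<longlonglongrightarrow> (\<integral>y. f y \<partial>\<nu>)"
    if "continuous_on circle f" for f :: "complex \<Rightarrow> real"
    using w that compact_imp_bounded[OF compact_continuous_image[OF that compact_circle]]
    unfolding circle_weak_conv_def by blast
  have "(\<lambda>n. \<integral>y. Re (y powi l) \<partial>\<mu> n) \<longlonglongrightarrow> (\<integral>y. Re (y powi l) \<partial>\<nu>)"
    "(\<lambda>n. \<integral>y. Im (y powi l) \<partial>\<mu> n) \<longlonglongrightarrow> (\<integral>y. Im (y powi l) \<partial>\<nu>)"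
    by (intro weak continuous_on_Re continuous_on_Im continuous_on_circle_powi)+
  then have lim: "(\<lambda>n. Complex (\<integral>y. Re (y powi l) \<partial>\<mu> n) (\<integral>y. Im (y powi l) \<partial>\<mu> n))
      \<longlonglongrightarrow> Complex (\<integral>y. Re (y powi l) \<partial>\<nu>) (\<integral>y. Im (y powi l) \<partial>\<nu>)"
    by (rule tendsto_Complex)
  have split: "Complex (\<integral>y. Re (y powi l) \<partial>\<kappa>) (\<integral>y. Im (y powi l) \<partial>\<kappa>) = (\<integral>y. y powi l \<partial>\<kappa>)"
    if "circle_prob \<kappa>" for \<kappa>
    using int[OF that] by (simp add: complex_eq_iff)
  have "\<forall>\<^sub>F n in sequentially.
      Complex (\<integral>y. Re (y powi l) \<partial>\<mu> n) (\<integral>y. Im (y powi l) \<partial>\<mu> n) = (\<integral>y. y powi l \<partial>\<mu> n)"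
    using \<mu> by eventually_elim (rule split)
  from Lim_transform_eventually[OF lim this]
  show "(\<lambda>n. \<integral>y. y powi l \<partial>\<mu> n) \<longlonglongrightarrow> (\<integral>y. y powi l \<partial>\<nu>)"
    by (simp add: split[OF \<nu>])
next
  assume coeff: "\<forall>l::int. (\<lambda>n. \<integral>y. y powi l \<partial>\<mu> n) \<longlonglongrightarrow> (\<integral>y. y powi l \<partial>\<nu>)"
  show "circle_weak_conv \<mu> \<nu>"
    unfolding circle_weak_conv_def
  proof (intro allI impI tendstoI)
    fix f :: "complex \<Rightarrow> real" and e :: real
    assume f: "continuous_on circle f" and e: "0 < e"
    obtain g where g: "real_polynomial_function g" "\<And>z. z \<in> circle \<Longrightarrow> \<bar>f z - g z\<bar> < e / 3"
      using Stone_Weierstrass_real_polynomial_function[OF compact_circle f, of "e / 3"] e by auto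
    have cont: "continuous_on circle g"
      using g(1) real_polynomial_function_eq continuous_on_polymonial_function by blast
    have "(\<lambda>n. \<integral>y. complex_of_real (g y) \<partial>\<mu> n) \<longlonglongrightarrow> (\<integral>y. complex_of_real (g y) \<partial>\<nu>)"
      using tendsto_integral_trig_poly[OF \<mu> \<nu>] coeff trig_poly_of_real_polynomial[OF g(1)]
      by blast
    then have "(\<lambda>n. \<integral>y. g y \<partial>\<mu> n) \<longlonglongrightarrow> (\<integral>y. g y \<partial>\<nu>)"
      by (simp add: tendsto_of_real_iff)
    then have "\<forall>\<^sub>F n in sequentially. dist (\<integral>y. g y \<partial>\<mu> n) (\<integral>y. g y \<partial>\<nu>) < e / 3"
      using e by (intro tendstoD) auto
    with \<mu> show "\<forall>\<^sub>F n in sequentially. dist (\<integral>y. f y \<partial>\<mu> n) (\<integral>y. f y \<partial>\<nu>) < e"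
    proof eventually_elim
      case (elim n)
      \<comment> \<open>Replacing f by g costs e / 3 under \<mu> n and again under \<nu>; the
        integrals of g differ by less than e / 3.\<close>
      have "\<bar>(\<integral>y. f y \<partial>\<kappa>) - (\<integral>y. g y \<partial>\<kappa>)\<bar> \<le> e / 3" if "circle_prob \<kappa>" for \<kappa>
        using that f cont g(2) by (intro integral_circle_close less_imp_le)
      from this[OF elim(1)] this[OF \<nu>] elim(2) show ?case
        unfolding dist_real_def by linarith
    qed
  qed
qed

section \<open>Measures on the circle are determined by their Fourier coefficients\<close>

text \<open>Off a closed set the distance is positive, so the functions vanish there eventually.
  Nonemptiness excludes the convention that \<open>infdist\<close> to the empty set is 0.\<close>

lemma tendsto_indicator_closed:
  fixes F :: "'a::metric_space set"
  assumes "closed F" "F \<noteq> {}"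
  shows "(\<lambda>n. max 0 (1 - real n * infdist z F)) \<longlonglongrightarrow> indicator F z"
proof (cases "z \<in> F")
  case True
  then show ?thesis by (simp add: infdist_zero)
next
  case False
  then have d: "0 < infdist z F"
    using assms infdist_pos_not_in_closed by blast
  have "\<forall>\<^sub>F n in sequentially. 1 / infdist z F < real n"
    using filterlim_real_sequentially by (simp add: filterlim_at_top_dense)
  then have "\<forall>\<^sub>F n in sequentially. max 0 (1 - real n * infdist z F) = 0"
    by eventually_elim (use d in \<open>simp add: field_simps\<close>)
  then show ?thesis
    using False by (simp add: tendsto_eventually)
qed

text \<open>Dominated convergence along continuous approximations of indicators gives equality on
  closed sets, an intersection-stable generator of the Borel sets.\<close>

lemma circle_prob_eqI_continuous:
  assumes \<mu>: "circle_prob \<mu>" and \<nu>: "circle_prob \<nu>"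
    and eq: "\<And>f :: complex \<Rightarrow> real. continuous_on circle f \<Longrightarrow> (\<integral>y. f y \<partial>\<mu>) = (\<integral>y. f y \<partial>\<nu>)"
  shows "\<mu> = \<nu>"
proof -
  have id: "(\<lambda>z. z) \<in> borel_measurable \<kappa>" if "circle_prob \<kappa>" for \<kappa>
    using that by (rule borel_measurable_circle) (rule continuous_on_id)
  \<comment> \<open>Pushing forward along the identity into \<open>borel\<close> places the measures
    on the whole plane, where closed sets generate the sigma-algebra.\<close>
  have lim: "(\<lambda>n. \<integral>z. max 0 (1 - real n * infdist z F) \<partial>\<kappa>) \<longlonglongrightarrow> measure (distr \<kappa> borel (\<lambda>z. z)) F"
    if \<kappa>: "circle_prob \<kappa>" and F: "closed F" "F \<noteq> {}" for \<kappa> F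
  proof -
    interpret prob_space \<kappa> using \<kappa> by (simp add: circle_prob_def)
    note [measurable] = id[OF \<kappa>]
    have [measurable]: "F \<in> sets borel" using F by simp
    have "(\<lambda>n. \<integral>z. max 0 (1 - real n * infdist z F) \<partial>\<kappa>) \<longlonglongrightarrow> (\<integral>z. indicator F z \<partial>\<kappa>)"
    proof (rule integral_dominated_convergence[where w = "\<lambda>_. 1"])
      show "(\<lambda>z. indicator F z :: real) \<in> borel_measurable \<kappa>" by measurable
      show "(\<lambda>z. max 0 (1 - real n * infdist z F)) \<in> borel_measurable \<kappa>" for n
        by (intro borel_measurable_circle[OF \<kappa>] continuous_intros)
    qed (auto intro!: tendsto_indicator_closed F AE_I2 mult_nonneg_nonneg infdist_nonneg)
    also have "(\<integral>z. indicator F z \<partial>\<kappa>) = measure (distr \<kappa> borel (\<lambda>z. z)) F"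
      by (simp add: measure_distr)
    finally show ?thesis .
  qed
  have prob: "prob_space (distr \<kappa> borel (\<lambda>z. z))" if "circle_prob \<kappa>" for \<kappa>
    using that id[OF that] by (auto simp: circle_prob_def intro!: prob_space.prob_space_distr)
  have closed_eq: "emeasure (distr \<mu> borel (\<lambda>z. z)) F = emeasure (distr \<nu> borel (\<lambda>z. z)) F"
    if F: "closed F" for F
  proof (cases "F = {}")
    case False
    have "(\<integral>z. max 0 (1 - real n * infdist z F) \<partial>\<mu>) = (\<integral>z. max 0 (1 - real n * infdist z F) \<partial>\<nu>)" for n
      by (intro eq continuous_intros)
    then have "measure (distr \<mu> borel (\<lambda>z. z)) F = measure (distr \<nu> borel (\<lambda>z. z)) F"
      using lim[OF \<mu> F False] lim[OF \<nu> F False] LIMSEQ_unique by simp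
    then show ?thesis
      using prob[OF \<mu>] prob[OF \<nu>]
      by (simp add: finite_measure.emeasure_eq_measure prob_space_def)
  qed simp
  have borel_sets: "sets (borel :: complex measure) = sigma_sets UNIV (Collect closed)"
    by (simp add: borel_eq_closed)
  have borel_eq: "distr \<mu> borel (\<lambda>z. z) = distr \<nu> borel (\<lambda>z. z)"
  proof (rule measure_eqI_generator_eq[of "Collect closed" UNIV _ _ "\<lambda>_. UNIV"])
    show "Int_stable (Collect closed)" by (auto simp: Int_stable_def)
    show "emeasure (distr \<mu> borel (\<lambda>z. z)) UNIV \<noteq> \<infinity>" for i :: nat
      using prob[OF \<mu>] by (simp add: finite_measure.emeasure_eq_measure prob_space_def)
  qed (auto simp: closed_eq borel_sets)
  show ?thesis
  proof (rule measure_eqI)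
    show "sets \<mu> = sets \<nu>" using \<mu> \<nu> by (simp add: circle_prob_def)
    fix A assume A: "A \<in> sets \<mu>"
    have "closed circle" using compact_circle compact_imp_closed by blast
    then have AB: "A \<in> sets borel" "A \<subseteq> circle"
      using A \<mu> by (auto simp: circle_prob_def circle_borel_def sets_restrict_space)
    have "emeasure \<kappa> A = emeasure (distr \<kappa> borel (\<lambda>z. z)) A" if "circle_prob \<kappa>" for \<kappa>
      using AB id[OF that] space_circle_prob[OF that] by (simp add: emeasure_distr Int_absorb2)
    then show "emeasure \<mu> A = emeasure \<nu> A" using borel_eq \<mu> \<nu> by metis
  qed
qed

text \<open>Equal coefficients make the constant sequence \<mu> converge weakly to \<nu>, so both
  integrate every continuous function alike.\<close>

lemma circle_prob_eqI:
  assumes \<mu>: "circle_prob \<mu>" and \<nu>: "circle_prob \<nu>"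
    and eq: "\<And>l::int. (\<integral>y. y powi l \<partial>\<mu>) = (\<integral>y. y powi l \<partial>\<nu>)"
  shows "\<mu> = \<nu>"
proof (rule circle_prob_eqI_continuous[OF \<mu> \<nu>])
  fix f :: "complex \<Rightarrow> real"
  assume f: "continuous_on circle f"
  have "circle_weak_conv (\<lambda>_. \<mu>) \<nu>"
    by (subst circle_weak_conv_iff_coeff) (simp_all add: \<mu> \<nu> eq)
  then have "(\<lambda>_::nat. \<integral>y. f y \<partial>\<mu>) \<longlonglongrightarrow> (\<integral>y. f y \<partial>\<nu>)"
    using f compact_imp_bounded[OF compact_continuous_image[OF f compact_circle]]
    unfolding circle_weak_conv_def by blast
  then show "(\<integral>y. f y \<partial>\<mu>) = (\<integral>y. f y \<partial>\<nu>)"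
    by (simp add: LIMSEQ_const_iff)
qed

section \<open>The Gauss and Haar measures\<close>

lemma circle_prob_distr:
  assumes "prob_space M" "f \<in> measurable M circle_borel"
  shows "circle_prob (distr M circle_borel f)"
  using assms by (simp add: circle_prob_def prob_space.prob_space_distr)

lemma measurable_powi_circle_borel: "(\<lambda>y. y powi l) \<in> borel_measurable circle_borel"
  unfolding circle_borel_def
  by (rule borel_measurable_continuous_on_restrict[OF continuous_on_circle_powi])

lemma measurable_cis_circle_borel: "(\<lambda>t. cis (a * t)) \<in> measurable borel circle_borel"
  unfolding circle_borel_def
  by (intro measurable_restrict_space2 borel_measurable_continuous_onI continuous_intros)
    (simp add: cis_in_circle)

text \<open>Wrapping a law on the line around the circle samples its characteristic function, since
  \<open>cis (a * t) powi l\<close> is exp (i l a t).\<close>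

lemma coeff_distr_cis:
  assumes "sets N = sets borel"
  shows "(\<integral>y. y powi l \<partial>distr N circle_borel (\<lambda>t. cis (a * t))) = char N (of_int l * a)"
proof -
  have "(\<integral>y. y powi l \<partial>distr N circle_borel (\<lambda>t. cis (a * t))) = (\<integral>t. cis (a * t) powi l \<partial>N)"
    using measurable_cis_circle_borel[of a] assms
    by (intro integral_distr measurable_powi_circle_borel) (simp cong: measurable_cong_sets)
  also have "\<dots> = char N (of_int l * a)"
    unfolding char_def by (simp only: cis_power_int) (simp only: cis_conv_exp mult.assoc)
  finally show ?thesis .
qed

text \<open>The description by \<open>THE\<close> is usable once existence and uniqueness hold. A
  centred normal variable of variance b, wrapped around the circle, is a witness; its coefficients
  make it unique.\<close>

lemma circle_gauss:
  assumes "0 \<le> b"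
  shows "circle_prob (circle_gauss b)"
    and "(\<integral>y. y powi l \<partial>circle_gauss b) = complex_of_real (exp (- b * (real_of_int l)\<^sup>2 / 2))"
proof -
  let ?P = "\<lambda>\<mu>. circle_prob \<mu> \<and>
    (\<forall>l::int. (\<integral>y. y powi l \<partial>\<mu>) = complex_of_real (exp (- b * (real_of_int l)\<^sup>2 / 2)))"
  let ?N = std_normal_distribution
  have ex: "?P (distr ?N circle_borel (\<lambda>t. cis (sqrt b * t)))"
  proof (intro conjI allI)
    show "circle_prob (distr ?N circle_borel (\<lambda>t. cis (sqrt b * t)))"
      using prob_space_normal_density measurable_cis_circle_borel
      by (intro circle_prob_distr) simp_all
    show "(\<integral>y. y powi l \<partial>distr ?N circle_borel (\<lambda>t. cis (sqrt b * t))) =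
        complex_of_real (exp (- b * (real_of_int l)\<^sup>2 / 2))" for l
      using assms
      by (subst coeff_distr_cis)
        (simp_all add: char_std_normal_distribution power_mult_distrib mult.commute)
  qed
  have unique: "\<mu> = \<nu>" if "?P \<mu>" "?P \<nu>" for \<mu> \<nu>
    by (rule circle_prob_eqI) (use that in simp_all)
  have "?P (circle_gauss b)"
    unfolding circle_gauss_def by (rule theI[of ?P, OF ex unique[OF _ ex]])
  then show "circle_prob (circle_gauss b)"
    and "(\<integral>y. y powi l \<partial>circle_gauss b) = complex_of_real (exp (- b * (real_of_int l)\<^sup>2 / 2))"
    by auto
qed

text \<open>The integral runs over whole periods: the primitive
  \<open>cis (of_int l * t) / (\<i> * of_int l)\<close> takes the same value at both
  endpoints.\<close>

lemma char_uniform_2pi: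
  fixes l :: int
  assumes "l \<noteq> 0"
  shows "char (uniform_measure lborel {-pi..pi}) (of_int l) = 0"
proof -
  let ?f = "\<lambda>t. cis (of_int l * t)"
  have eq: "uniform_measure lborel {-pi..pi} =
      density lborel (\<lambda>t. ennreal (indicator {-pi..pi} t / (2 * pi)))"
    unfolding uniform_measure_def
    by (simp add: divide_ennreal[symmetric] ennreal_indicator)
  have "(\<integral>t. indicator {-pi..pi} t *\<^sub>R ?f t \<partial>lborel) =
      ?f pi / (\<i> * of_int l) - ?f (-pi) / (\<i> * of_int l)"
  proof (rule integral_FTC_Icc)
    fix t :: real
    have "((\<lambda>z. exp (\<i> * (of_int l * z)) / (\<i> * of_int l)) has_field_derivative
        exp (\<i> * (of_int l * of_real t))) (at (of_real t))"
      using assms by (auto intro!: derivative_eq_intros simp: mult.commute[of _ \<i>])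
    from has_vector_derivative_real_field[OF this]
    show "((\<lambda>t. ?f t / (\<i> * of_int l)) has_vector_derivative ?f t) (at t within {-pi..pi})"
      by (simp add: cis_conv_exp)
  qed (auto intro!: continuous_intros)
  also have "?f pi = ?f (-pi)"
    by (simp add: complex_eq_iff sin_times_pi_eq_0)
  finally have "(\<integral>t. indicator {-pi..pi} t *\<^sub>R ?f t \<partial>lborel) = 0"
    by simp
  then have "(\<integral>t. (1 / (2 * pi)) *\<^sub>R (indicator {-pi..pi} t *\<^sub>R ?f t) \<partial>lborel) = 0"
    by (simp only: Bochner_Integration.integral_scaleR_right scaleR_zero_right)
  then show ?thesis
    unfolding eq char_def
    by (subst integral_density)
      (auto intro!: borel_measurable_continuous_onI continuous_intros simp: cis_conv_exp)
qed

lemma coeff_circle_zero: "circle_prob \<mu> \<Longrightarrow> (\<integral>y. y powi 0 \<partial>\<mu>) = 1"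
  using prob_space.prob_space[of \<mu>] by (simp add: circle_prob_def)

text \<open>This turns invariance under rotation into a condition on coefficients, both for
  existence and for uniqueness of the Haar measure.\<close>

lemma coeff_rotate:
  assumes \<mu>: "circle_prob \<mu>" and z: "z \<in> circle"
  shows "circle_prob (distr \<mu> circle_borel (\<lambda>y. z * y))"
    and "(\<integral>y. y powi l \<partial>distr \<mu> circle_borel (\<lambda>y. z * y)) = z powi l * (\<integral>y. y powi l \<partial>\<mu>)"
proof -
  have rot: "(\<lambda>y. z * y) \<in> measurable \<mu> circle_borel"
    unfolding circle_borel_def
    by (intro measurable_restrict_space2 borel_measurable_circle[OF \<mu>] continuous_intros)
      (simp add: space_circle_prob[OF \<mu>] z mult_in_circle)
  then show "circle_prob (distr \<mu> circle_borel (\<lambda>y. z * y))"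
    using \<mu> by (intro circle_prob_distr) (simp_all add: circle_prob_def)
  show "(\<integral>y. y powi l \<partial>distr \<mu> circle_borel (\<lambda>y. z * y)) = z powi l * (\<integral>y. y powi l \<partial>\<mu>)"
    using rot by (simp add: integral_distr measurable_powi_circle_borel power_int_mult_distrib)
qed

lemma circle_haar:
  shows "circle_prob circle_haar"
    and "(\<integral>y. y powi l \<partial>circle_haar) = (if l = 0 then 1 else 0)"
proof -
  let ?P = "\<lambda>\<mu>. circle_prob \<mu> \<and> (\<forall>z\<in>circle. distr \<mu> circle_borel (\<lambda>y. z * y) = \<mu>)"
  let ?N = "uniform_measure lborel {-pi..pi}"
  \<comment> \<open>The factor \<open>1\<close> fits the shape of
    \<open>coeff_distr_cis\<close>.\<close>
  let ?H = "distr ?N circle_borel (\<lambda>t. cis (1 * t))"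
  have H: "circle_prob ?H"
    using measurable_cis_circle_borel[of 1]
    by (intro circle_prob_distr prob_space_uniform_measure) (simp_all cong: measurable_cong_sets)
  have coeff: "(\<integral>y. y powi l \<partial>?H) = (if l = 0 then 1 else 0)" for l
  proof (cases "l = 0")
    case True
    then show ?thesis using coeff_circle_zero[OF H] by simp
  next
    case False
    then show ?thesis by (subst coeff_distr_cis) (simp_all add: char_uniform_2pi)
  qed
  \<comment> \<open>Rotation multiplies the coefficient at l = 0 by 1 and all others are 0, so no
    coefficient changes.\<close>
  have "distr ?H circle_borel (\<lambda>y. z * y) = ?H" if "z \<in> circle" for z
    by (rule circle_prob_eqI[OF coeff_rotate(1)[OF H that] H])
      (unfold coeff_rotate(2)[OF H that] coeff, simp)
  with H have "?P ?H" by blast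
  moreover have coeff_unique: "(\<integral>y. y powi l \<partial>\<mu>) = (if l = 0 then 1 else 0)" if "?P \<mu>" for \<mu> l
  proof (cases "l = 0")
    case True
    then show ?thesis using coeff_circle_zero that by simp
  next
    case False
    \<comment> \<open>Rotation by a \<open>z\<close> with \<open>z powi l = -1\<close> negates the \<open>l\<close>-th coefficient.\<close>
    have "(\<integral>y. y powi l \<partial>\<mu>) = cis (pi / of_int l) powi l * (\<integral>y. y powi l \<partial>\<mu>)"
      using that coeff_rotate(2)[of \<mu> "cis (pi / of_int l)" l] cis_in_circle by simp
    then have "(\<integral>y. y powi l \<partial>\<mu>) = - (\<integral>y. y powi l \<partial>\<mu>)"
      using False by (simp add: cis_power_int)
    then show ?thesis using False by simp
  qed
  ultimately have "?P circle_haar"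
    unfolding circle_haar_def
    by (intro theI[of ?P]) (auto intro!: circle_prob_eqI)
  then show "circle_prob circle_haar" "(\<integral>y. y powi l \<partial>circle_haar) = (if l = 0 then 1 else 0)"
    using coeff_unique by auto
qed

section \<open>The argument near the identity\<close>

text \<open>The two conventions differ only at -1, where \<open>Arg\<close> is pi and
  \<open>circle_arg\<close> is -pi.\<close>

lemma circle_arg_eq_Arg:
  assumes "z \<in> circle" "Arg z \<noteq> pi"
  shows "circle_arg z = Arg z"
  unfolding circle_arg_def
proof (rule the_equality)
  show "- pi \<le> Arg z \<and> Arg z < pi \<and> cis (Arg z) = z"
    using assms Arg_bounded[of z] by (auto simp: cis_Arg circle_nonzero sgn_eq circle_def)
next
  fix t assume t: "- pi \<le> t \<and> t < pi \<and> cis t = z"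
  have "t \<noteq> - pi"
  proof
    assume "t = - pi"
    then have "z = cis pi" using t by (simp add: complex_eq_iff)
    then show False using assms(2) Arg_cis[of pi] by simp
  qed
  then show "t = Arg z"
    using t Arg_cis[of t] by auto
qed

text \<open>Near 1 the cut at -1 is out of reach, so the continuity of \<open>Arg\<close> at 1
  transfers to \<open>circle_arg\<close>.\<close>

lemma circle_arg_tendsto:
  assumes "\<forall>\<^sub>F n in sequentially. x n \<in> circle" "x \<longlonglongrightarrow> 1"
  shows "(\<lambda>n. circle_arg (x n)) \<longlonglongrightarrow> 0"
    and "\<forall>\<^sub>F n in sequentially. cis (circle_arg (x n)) = x n"
proof -
  have Arg: "(\<lambda>n. Arg (x n)) \<longlonglongrightarrow> 0"
    using isCont_tendsto_compose[OF continuous_at_Arg[of 1] assms(2)] by simp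
  then have "\<forall>\<^sub>F n in sequentially. Arg (x n) < pi"
    by (rule order_tendstoD) simp
  with assms(1) have eq: "\<forall>\<^sub>F n in sequentially. Arg (x n) = circle_arg (x n)"
    by eventually_elim (simp add: circle_arg_eq_Arg)
  from Lim_transform_eventually[OF Arg eq] show "(\<lambda>n. circle_arg (x n)) \<longlonglongrightarrow> 0" .
  from eq assms(1) show "\<forall>\<^sub>F n in sequentially. cis (circle_arg (x n)) = x n"
    by eventually_elim (metis circle_def cis_Arg circle_nonzero dist_0_norm div_by_1
        mem_sphere of_real_1 sgn_eq)
qed

section \<open>Fourier coefficients of the row products\<close>

text \<open>The mean of \<open>x powi l\<close> and its inverse is the mean of cis (l a) and cis (-
  l a), which is real.\<close>

lemma integral_symmetric_two_point:
  assumes "prob_space M" and X: "X \<in> measurable M circle_borel" and x: "cis a = x"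
    and law: "\<And>A. A \<in> sets circle_borel \<Longrightarrow>
      measure (distr M circle_borel X) A =
        1 / 2 * (measure (return circle_borel x) A + measure (return circle_borel (inverse x)) A)"
  shows "(\<integral>\<omega>. X \<omega> powi l \<partial>M) = complex_of_real (cos (of_int l * a))"
proof -
  interpret prob_space M by fact
  \<comment> \<open>The law is known only through its values on sets; as the image of a fair coin it
    turns the integral into a sum of two terms.\<close>
  define T where "T = distr (measure_pmf (bernoulli_pmf (1/2))) circle_borel
    (\<lambda>c. if c then x else inverse x)"
  have xc: "x \<in> circle" "inverse x \<in> circle"
    using x cis_in_circle inverse_in_circle by blast+
  then have meas: "(\<lambda>c. if c then x else inverse x)
      \<in> measurable (measure_pmf (bernoulli_pmf (1/2))) circle_borel"
    by (simp add: space_circle_borel)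
  interpret X: prob_space "distr M circle_borel X"
    using X by (rule prob_space_distr)
  interpret T: prob_space T
    unfolding T_def using meas by (rule measure_pmf.prob_space_distr)
  have "distr M circle_borel X = T"
  proof (rule measure_eqI)
    fix A assume "A \<in> sets (distr M circle_borel X)"
    then have A: "A \<in> sets circle_borel" by simp
    have "measure T A = (\<integral>y. indicator A y \<partial>T)"
      using A sets.sets_into_space[OF A] by (simp add: T_def Int_absorb2)
    also have "\<dots> = (\<integral>c. indicator A (if c then x else inverse x) \<partial>bernoulli_pmf (1/2))"
      unfolding T_def using A meas by (intro integral_distr) auto
    also have "\<dots> = measure (distr M circle_borel X) A"
      using A by (simp add: law measure_return field_simps)
    finally show "emeasure (distr M circle_borel X) A = emeasure T A"
      by (simp add: X.emeasure_eq_measure T.emeasure_eq_measure)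
  qed (simp add: T_def)
  then have "(\<integral>\<omega>. X \<omega> powi l \<partial>M) = (\<integral>y. y powi l \<partial>T)"
    using X integral_distr[OF X measurable_powi_circle_borel] by metis
  also have "\<dots> = (\<integral>c. (if c then x else inverse x) powi l \<partial>bernoulli_pmf (1/2))"
    unfolding T_def by (rule integral_distr[OF meas measurable_powi_circle_borel])
  also have "\<dots> = (x powi l + inverse x powi l) / 2"
    by (subst integral_measure_pmf[of UNIV]) (simp_all add: UNIV_bool scaleR_conv_of_real)
  also have "\<dots> = complex_of_real (cos (of_int l * a))"
    unfolding x[symmetric] by (simp add: cis_inverse cis_power_int complex_eq_iff)
  finally show ?thesis .
qed

text \<open>Integer powers are multiplicative, so independence factors the expectation; the factors
  are integrable because they have modulus one.\<close>

lemma (in prob_space) coeff_prod_circle: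
  assumes I: "finite I" and indep: "indep_vars (\<lambda>_. circle_borel) X I"
    and coeff: "\<And>k. k \<in> I \<Longrightarrow> (\<integral>\<omega>. X k \<omega> powi l \<partial>M) = c"
  shows "circle_prob (distr M circle_borel (\<lambda>\<omega>. \<Prod>k\<in>I. X k \<omega>))"
    and "(\<integral>y. y powi l \<partial>distr M circle_borel (\<lambda>\<omega>. \<Prod>k\<in>I. X k \<omega>)) = c ^ card I"
proof -
  have X: "X k \<in> measurable M circle_borel" if "k \<in> I" for k
    using indep that by (auto simp: indep_vars_def)
  have in_circle: "X k \<omega> \<in> circle" if "k \<in> I" "\<omega> \<in> space M" for k \<omega>
    using measurable_space[OF X] that by (simp add: space_circle_borel)
  have [measurable]: "X k \<in> borel_measurable M" if "k \<in> I" for k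
    using X[OF that] by (simp add: circle_borel_def measurable_restrict_space2_iff)
  have prod: "(\<lambda>\<omega>. \<Prod>k\<in>I. X k \<omega>) \<in> measurable M circle_borel"
    unfolding circle_borel_def
    by (intro measurable_restrict_space2 borel_measurable_prod)
      (use in_circle in \<open>auto simp: circle_def prod_norm[symmetric]\<close>)
  then show "circle_prob (distr M circle_borel (\<lambda>\<omega>. \<Prod>k\<in>I. X k \<omega>))"
    by (rule circle_prob_distr[OF prob_space_axioms])
  have "(\<Prod>k\<in>I. y k) powi l = (\<Prod>k\<in>I. y k powi l)" for y :: "_ \<Rightarrow> complex"
    by (induction I rule: infinite_finite_induct) (simp_all add: power_int_mult_distrib)
  then have "(\<integral>y. y powi l \<partial>distr M circle_borel (\<lambda>\<omega>. \<Prod>k\<in>I. X k \<omega>)) =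
      (\<integral>\<omega>. (\<Prod>k\<in>I. X k \<omega> powi l) \<partial>M)"
    by (simp add: integral_distr[OF prod measurable_powi_circle_borel])
  also have "\<dots> = (\<Prod>k\<in>I. \<integral>\<omega>. X k \<omega> powi l \<partial>M)"
  proof (rule indep_vars_lebesgue_integral[OF I])
    show "indep_vars (\<lambda>_. borel) (\<lambda>k \<omega>. X k \<omega> powi l) I"
      by (rule indep_vars_compose2[OF indep measurable_powi_circle_borel])
    show "integrable M (\<lambda>\<omega>. X k \<omega> powi l)" if "k \<in> I" for k
      using in_circle[OF that] measurable_compose[OF X[OF that] measurable_powi_circle_borel]
      by (intro integrable_const_bound[of _ 1])
        (auto simp: circle_def norm_power_int intro!: AE_I2)
  qed
  also have "\<dots> = c ^ card I" by (simp add: coeff)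
  finally show "(\<integral>y. y powi l \<partial>distr M circle_borel (\<lambda>\<omega>. \<Prod>k\<in>I. X k \<omega>)) = c ^ card I" .
qed

section \<open>Asymptotics of powers of the cosine\<close>

text \<open>The value at \<open>0\<close> makes the function continuous there.\<close>

definition ln_cos_quot :: "real \<Rightarrow> real" where
  "ln_cos_quot t = (if t = 0 then - 1 / 2 else ln (cos t) / t\<^sup>2)"

text \<open>This is the expansion ln (cos t) = - t^2 / 2 + o(t^2).\<close>

lemma tendsto_ln_cos_quot: "ln_cos_quot \<midarrow>0\<rightarrow> - 1 / 2"
proof -
  have "((\<lambda>t::real. ln (cos t) / t\<^sup>2) \<longlongrightarrow> - 1 / 2) (at 0)"
    by real_asymp
  then show ?thesis
    by (rule Lim_transform_eventually) (auto simp: eventually_at_filter ln_cos_quot_def)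
qed

lemma isCont_ln_cos_quot: "isCont ln_cos_quot 0"
  using tendsto_ln_cos_quot by (simp add: isCont_def ln_cos_quot_def)

lemma exp_ln_cos_quot:
  assumes "0 < cos t"
  shows "exp (t\<^sup>2 * ln_cos_quot t) = cos t"
  using assms by (simp add: ln_cos_quot_def)

text \<open>Since c * a n tends to 0, the cosine is eventually positive and its logarithm is
  meaningful. The exponent isolates the quantity \<open>real (K n) * (a n)\<^sup>2\<close>.\<close>

lemma cos_power_eq_exp:
  assumes a: "a \<longlonglongrightarrow> 0"
  shows "\<forall>\<^sub>F n in sequentially.
    cos (c * a n) ^ K n = exp ((real (K n) * (a n)\<^sup>2) * (c\<^sup>2 * ln_cos_quot (c * a n)))"
proof -
  have "(\<lambda>n. cos (c * a n)) \<longlonglongrightarrow> cos (c * 0)"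
    by (intro tendsto_intros a)
  then have "\<forall>\<^sub>F n in sequentially. 0 < cos (c * a n)"
    by (rule order_tendstoD) simp
  then show ?thesis
  proof eventually_elim
    case (elim n)
    have "cos (c * a n) ^ K n = exp ((c * a n)\<^sup>2 * ln_cos_quot (c * a n)) ^ K n"
      using elim by (simp add: exp_ln_cos_quot)
    also have "\<dots> = exp (real (K n) * ((c * a n)\<^sup>2 * ln_cos_quot (c * a n)))"
      by (simp add: exp_of_nat_mult)
    finally show ?case by (simp add: power_mult_distrib ac_simps)
  qed
qed

text \<open>The argument c * a n may equal 0, so continuity at 0 is used instead of the punctured
  limit.\<close>

lemma tendsto_ln_cos_quot_scaled:
  assumes "a \<longlonglongrightarrow> 0"
  shows "(\<lambda>n. ln_cos_quot (c * a n)) \<longlonglongrightarrow> - 1 / 2"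
proof -
  have "(\<lambda>n. c * a n) \<longlonglongrightarrow> 0"
    using tendsto_mult_right_zero[OF assms] by simp
  from isCont_tendsto_compose[OF isCont_ln_cos_quot this] show ?thesis
    by (simp add: ln_cos_quot_def)
qed

lemma cos_power_tendsto_gauss_iff:
  assumes a: "a \<longlonglongrightarrow> 0"
  shows "(\<forall>l::int. (\<lambda>n. cos (of_int l * a n) ^ K n) \<longlonglongrightarrow> exp (- b * (of_int l)\<^sup>2 / 2))
    \<longleftrightarrow> (\<lambda>n. real (K n) * (a n)\<^sup>2) \<longlonglongrightarrow> b"
proof (intro iffI allI)
  fix l :: int
  assume "(\<lambda>n. real (K n) * (a n)\<^sup>2) \<longlonglongrightarrow> b"
  then have "(\<lambda>n. exp ((real (K n) * (a n)\<^sup>2) * ((of_int l)\<^sup>2 * ln_cos_quot (of_int l * a n))))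
      \<longlonglongrightarrow> exp (b * ((of_int l)\<^sup>2 * (- 1 / 2)))"
    by (intro tendsto_intros tendsto_ln_cos_quot_scaled a)
  moreover have "exp (b * ((of_int l)\<^sup>2 * (- 1 / 2))) = exp (- b * (of_int l)\<^sup>2 / 2)"
    by simp
  ultimately show "(\<lambda>n. cos (of_int l * a n) ^ K n) \<longlonglongrightarrow> exp (- b * (of_int l)\<^sup>2 / 2)"
    using tendsto_cong[OF cos_power_eq_exp[OF a]] by simp
next
  assume "\<forall>l::int. (\<lambda>n. cos (of_int l * a n) ^ K n) \<longlonglongrightarrow> exp (- b * (of_int l)\<^sup>2 / 2)"
  \<comment> \<open>The coefficient l = 1 alone determines b, after taking logarithms.\<close>
  then have "(\<lambda>n. cos (1 * a n) ^ K n) \<longlonglongrightarrow> exp (- b / 2)"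
    by (elim allE[of _ 1]) simp
  then have "(\<lambda>n. exp ((real (K n) * (a n)\<^sup>2) * (1\<^sup>2 * ln_cos_quot (1 * a n)))) \<longlonglongrightarrow> exp (- b / 2)"
    using tendsto_cong[OF cos_power_eq_exp[OF a, of 1 K]] by blast
  then have "(\<lambda>n. ln (exp ((real (K n) * (a n)\<^sup>2) * (1\<^sup>2 * ln_cos_quot (1 * a n)))))
      \<longlonglongrightarrow> ln (exp (- b / 2))"
    by (rule tendsto_ln) simp
  then have "(\<lambda>n. (real (K n) * (a n)\<^sup>2) * ln_cos_quot (a n)) \<longlonglongrightarrow> - b / 2"
    by simp
  moreover have g: "(\<lambda>n. ln_cos_quot (a n)) \<longlonglongrightarrow> - 1 / 2"
    using tendsto_ln_cos_quot_scaled[OF a, of 1] by simp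
  ultimately have "(\<lambda>n. (real (K n) * (a n)\<^sup>2) * ln_cos_quot (a n) / ln_cos_quot (a n))
      \<longlonglongrightarrow> (- b / 2) / (- 1 / 2)"
    by (rule tendsto_divide) simp
  \<comment> \<open>Being eventually nonzero, the quotient cancels and leaves
    \<open>real (K n) * (a n)\<^sup>2\<close>.\<close>
  moreover have "\<forall>\<^sub>F n in sequentially. ln_cos_quot (a n) < 0"
    using g by (rule order_tendstoD) simp
  then have "\<forall>\<^sub>F n in sequentially.
      (real (K n) * (a n)\<^sup>2) * ln_cos_quot (a n) / ln_cos_quot (a n) = real (K n) * (a n)\<^sup>2"
    by eventually_elim simp
  ultimately show "(\<lambda>n. real (K n) * (a n)\<^sup>2) \<longlonglongrightarrow> b"
    using Lim_transform_eventually by fastforce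
qed

lemma cos_power_tendsto_haar_iff:
  assumes a: "a \<longlonglongrightarrow> 0"
  shows "(\<forall>l::int. (\<lambda>n. cos (of_int l * a n) ^ K n) \<longlonglongrightarrow> (if l = 0 then 1 else 0))
    \<longleftrightarrow> filterlim (\<lambda>n. real (K n) * (a n)\<^sup>2) at_top sequentially"
proof (intro iffI allI)
  fix l :: int
  assume K: "filterlim (\<lambda>n. real (K n) * (a n)\<^sup>2) at_top sequentially"
  show "(\<lambda>n. cos (of_int l * a n) ^ K n) \<longlonglongrightarrow> (if l = 0 then 1 else 0)"
  proof (cases "l = 0")
    case False
    have lim: "(\<lambda>n. (of_int l)\<^sup>2 * ln_cos_quot (of_int l * a n)) \<longlonglongrightarrow> (of_int l)\<^sup>2 * (- 1 / 2)"
      by (intro tendsto_intros tendsto_ln_cos_quot_scaled a)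
    \<comment> \<open>For nonzero l the factor tends to the negative number - l^2 / 2, so the
      exponent tends to minus infinity.\<close>
    have "filterlim (\<lambda>n. ((of_int l)\<^sup>2 * ln_cos_quot (of_int l * a n)) * (real (K n) * (a n)\<^sup>2))
        at_bot sequentially"
      by (rule filterlim_tendsto_neg_mult_at_bot[OF lim _ K]) (use False in simp)
    then have "(\<lambda>n. exp ((real (K n) * (a n)\<^sup>2) * ((of_int l)\<^sup>2 * ln_cos_quot (of_int l * a n)))) \<longlonglongrightarrow> 0"
      by (intro filterlim_compose[OF exp_at_bot]) (simp add: mult.commute)
    then show ?thesis
      using False tendsto_cong[OF cos_power_eq_exp[OF a]] by simp
  qed simp
next
  assume "\<forall>l::int. (\<lambda>n. cos (of_int l * a n) ^ K n) \<longlonglongrightarrow> (if l = 0 then 1 else 0)"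
  then have "(\<lambda>n. cos (1 * a n) ^ K n) \<longlonglongrightarrow> 0"
    by (elim allE[of _ 1]) simp
  then have "(\<lambda>n. exp ((real (K n) * (a n)\<^sup>2) * (1\<^sup>2 * ln_cos_quot (1 * a n)))) \<longlonglongrightarrow> 0"
    using tendsto_cong[OF cos_power_eq_exp[OF a, of 1 K]] by blast
  \<comment> \<open>Exponentials are positive, so the limit 0 is approached from the right and the
    logarithm tends to minus infinity.\<close>
  then have "filterlim (\<lambda>n. exp ((real (K n) * (a n)\<^sup>2) * ln_cos_quot (a n))) (at_right 0) sequentially"
    by (simp add: filterlim_at)
  then have "filterlim (\<lambda>n. ln (exp ((real (K n) * (a n)\<^sup>2) * ln_cos_quot (a n)))) at_bot sequentially"
    by (rule filterlim_compose[OF ln_at_0])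
  then have bot: "filterlim (\<lambda>n. (real (K n) * (a n)\<^sup>2) * ln_cos_quot (a n)) at_bot sequentially"
    by simp
  have g: "(\<lambda>n. ln_cos_quot (a n)) \<longlonglongrightarrow> - 1 / 2"
    using tendsto_ln_cos_quot_scaled[OF a, of 1] by simp
  \<comment> \<open>A lower bound -1 on the quotient makes \<open>real (K n) * (a n)\<^sup>2\<close>
    dominate a sequence that tends to infinity.\<close>
  then have "\<forall>\<^sub>F n in sequentially. - 1 < ln_cos_quot (a n)"
    by (rule order_tendstoD) simp
  then have "\<forall>\<^sub>F n in sequentially.
      - ((real (K n) * (a n)\<^sup>2) * ln_cos_quot (a n)) \<le> real (K n) * (a n)\<^sup>2"
  proof eventually_elim
    case (elim n)
    have "(real (K n) * (a n)\<^sup>2) * - ln_cos_quot (a n) \<le> (real (K n) * (a n)\<^sup>2) * 1"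
      using elim by (intro mult_left_mono) auto
    then show ?case by simp
  qed
  moreover have "filterlim (\<lambda>n. - ((real (K n) * (a n)\<^sup>2) * ln_cos_quot (a n))) at_top sequentially"
    using bot by (simp only: filterlim_uminus_at_bot)
  ultimately show "filterlim (\<lambda>n. real (K n) * (a n)\<^sup>2) at_top sequentially"
    by (rule filterlim_at_top_mono[rotated])
qed

section \<open>Infinitesimality and the limit theorem\<close>

text \<open>Both atoms tend to 1 and eventually lie in U, so the probabilities of leaving U are
  exactly 0 from some row on.\<close>

lemma circle_infinitesimal_two_point:
  assumes x: "\<And>n. n \<ge> 1 \<Longrightarrow> x n \<in> circle" "x \<longlonglongrightarrow> 1"
    and K_pos: "\<And>n. n \<ge> 1 \<Longrightarrow> K n \<ge> 1"
    and meas: "\<And>n k. n \<ge> 1 \<Longrightarrow> k \<in> {1..K n} \<Longrightarrow> X n k \<in> measurable (M n) circle_borel"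
    and law: "\<And>n k A. n \<ge> 1 \<Longrightarrow> k \<in> {1..K n} \<Longrightarrow> A \<in> sets circle_borel \<Longrightarrow>
      measure (distr (M n) circle_borel (X n k)) A =
        1 / 2 * (measure (return circle_borel (x n)) A
               + measure (return circle_borel (inverse (x n))) A)"
  shows "circle_infinitesimal M K X"
  unfolding circle_infinitesimal_def
proof (intro ballI impI)
  fix U assume U: "U \<in> sets circle_borel"
    and "\<exists>V. openin (top_of_set circle) V \<and> 1 \<in> V \<and> V \<subseteq> U"
  then obtain W where W: "open W" "1 \<in> W" "circle \<inter> W \<subseteq> U"
    by (auto simp: openin_open)
  have "\<forall>\<^sub>F n in sequentially. x n \<in> W"
    by (rule topological_tendstoD[OF x(2) W(1,2)])
  moreover have "(\<lambda>n. inverse (x n)) \<longlonglongrightarrow> 1"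
    using tendsto_inverse[OF x(2)] by simp
  then have "\<forall>\<^sub>F n in sequentially. inverse (x n) \<in> W"
    using topological_tendstoD W(1,2) by blast
  ultimately have "\<forall>\<^sub>F n in sequentially.
      (MAX k\<in>{1..K n}. measure (M n) {\<omega> \<in> space (M n). X n k \<omega> \<in> circle - U}) = 0"
    using eventually_ge_at_top[of 1]
  proof eventually_elim
    case (elim n)
    have A: "circle - U \<in> sets circle_borel"
      using sets.compl_sets[OF U] by (simp add: space_circle_borel)
    have in_U: "x n \<in> U" "inverse (x n) \<in> U"
      using elim W x(1) inverse_in_circle by auto
    have "measure (M n) {\<omega> \<in> space (M n). X n k \<omega> \<in> circle - U} = 0" if k: "k \<in> {1..K n}" for k
    proof -
      have "measure (M n) {\<omega> \<in> space (M n). X n k \<omega> \<in> circle - U} =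
          measure (distr (M n) circle_borel (X n k)) (circle - U)"
        by (subst measure_distr[OF meas[OF elim(3) k] A]) (rule arg_cong[of _ _ "measure _"], auto)
      also have "\<dots> = 0"
        using law[OF elim(3) k A] A in_U by (simp add: measure_return)
      finally show ?thesis .
    qed
    \<comment> \<open>As K n is at least 1, the maximum is over a nonempty set, and its image is
      {0}.\<close>
    then have "(\<lambda>k. measure (M n) {\<omega> \<in> space (M n). X n k \<omega> \<in> circle - U}) ` {1..K n} = {0}"
      using K_pos[OF elim(3)] by (force simp: image_iff)
    then show ?case by simp
  qed
  then show "(\<lambda>n. MAX k\<in>{1..K n}. measure (M n) {\<omega> \<in> space (M n). X n k \<omega> \<in> circle - U})
      \<longlonglongrightarrow> 0"
    by (rule tendsto_eventually)
qed

text \<open>Rows are numbered from 1 and row 0 is unconstrained, so properties of the rows enter the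
  limits as eventual statements. Identical distribution is contained in \<open>law\<close>, which
  does not depend on k.\<close>

theorem theorem6p3:
  fixes M :: "nat \<Rightarrow> 'a measure"
    and K :: "nat \<Rightarrow> nat"
    and X :: "nat \<Rightarrow> nat \<Rightarrow> 'a \<Rightarrow> complex"
    and x :: "nat \<Rightarrow> complex"
  assumes x_circle: "\<And>n. n \<ge> 1 \<Longrightarrow> x n \<in> circle"
    and x_lim: "x \<longlonglongrightarrow> 1"
    and K_pos: "\<And>n. n \<ge> 1 \<Longrightarrow> K n \<ge> 1"
    and K_lim: "filterlim K at_top sequentially"
    and prob: "\<And>n. n \<ge> 1 \<Longrightarrow> prob_space (M n)"
    and meas: "\<And>n k. n \<ge> 1 \<Longrightarrow> k \<in> {1..K n} \<Longrightarrow> X n k \<in> measurable (M n) circle_borel"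
    and indep: "\<And>n. n \<ge> 1 \<Longrightarrow>
      prob_space.indep_vars (M n) (\<lambda>_. circle_borel) (X n) {1..K n}"
    and law: "\<And>n k A. n \<ge> 1 \<Longrightarrow> k \<in> {1..K n} \<Longrightarrow> A \<in> sets circle_borel \<Longrightarrow>
      measure (distr (M n) circle_borel (X n k)) A =
        1 / 2 * (measure (return circle_borel (x n)) A
               + measure (return circle_borel (inverse (x n))) A)"
  shows "circle_infinitesimal M K X \<and>
    (\<forall>b::real. b \<ge> 0 \<longrightarrow>
      (circle_weak_conv
          (\<lambda>n. distr (M n) circle_borel (\<lambda>\<omega>. \<Prod>k=1..K n. X n k \<omega>)) (circle_gauss b)
        \<longleftrightarrow> (\<lambda>n. real (K n) * (circle_arg (x n))\<^sup>2) \<longlonglongrightarrow> b)) \<and>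
    (circle_weak_conv
        (\<lambda>n. distr (M n) circle_borel (\<lambda>\<omega>. \<Prod>k=1..K n. X n k \<omega>)) circle_haar
      \<longleftrightarrow> filterlim (\<lambda>n. real (K n) * (circle_arg (x n))\<^sup>2) at_top sequentially)"
proof -
  define \<mu> where "\<mu> = (\<lambda>n. distr (M n) circle_borel (\<lambda>\<omega>. \<Prod>k=1..K n. X n k \<omega>))"
  define a where "a = (\<lambda>n. circle_arg (x n))"
  have x_ev: "\<forall>\<^sub>F n in sequentially. x n \<in> circle"
    using x_circle by (auto simp: eventually_sequentially)
  have a: "a \<longlonglongrightarrow> 0" and cis_a: "\<forall>\<^sub>F n in sequentially. cis (a n) = x n"
    unfolding a_def using circle_arg_tendsto[OF x_ev x_lim] by auto
  have "\<forall>\<^sub>F n in sequentially. circle_prob (\<mu> n) \<and>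
      (\<forall>l. (\<integral>y. y powi l \<partial>\<mu> n) = complex_of_real (cos (of_int l * a n) ^ K n))"
    using cis_a eventually_ge_at_top[of 1]
  proof eventually_elim
    case (elim n)
    interpret prob_space "M n" using prob elim by blast
    have "(\<integral>\<omega>. X n k \<omega> powi l \<partial>M n) = complex_of_real (cos (of_int l * a n))"
      if "k \<in> {1..K n}" for k l
      using integral_symmetric_two_point[OF prob meas elim(1) law] that elim(2) by blast
    from coeff_prod_circle[OF finite_atLeastAtMost indep[OF elim(2)] this]
    show ?case by (simp add: \<mu>_def)
  qed
  then have \<mu>: "\<forall>\<^sub>F n in sequentially. circle_prob (\<mu> n)"
    and coeff: "\<And>l. \<forall>\<^sub>F n in sequentially.
      (\<integral>y. y powi l \<partial>\<mu> n) = complex_of_real (cos (of_int l * a n) ^ K n)"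
    by (auto elim: eventually_mono)
  \<comment> \<open>The limit \<nu> and its real coefficients c are kept general, so the Gauss and
    Haar cases are both instances.\<close>
  have weak: "circle_weak_conv \<mu> \<nu> \<longleftrightarrow> (\<forall>l::int. (\<lambda>n. cos (of_int l * a n) ^ K n) \<longlonglongrightarrow> c l)"
    if "circle_prob \<nu>" "\<And>l. (\<integral>y. y powi l \<partial>\<nu>) = complex_of_real (c l)" for \<nu> c
    unfolding circle_weak_conv_iff_coeff[OF \<mu> that(1)] that(2) tendsto_cong[OF coeff]
      tendsto_of_real_iff ..
  have "circle_infinitesimal M K X"
    using x_circle x_lim K_pos meas law by (rule circle_infinitesimal_two_point)
  moreover have "circle_weak_conv \<mu> (circle_gauss b) \<longleftrightarrow> (\<lambda>n. real (K n) * (a n)\<^sup>2) \<longlonglongrightarrow> b"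
    if "b \<ge> 0" for b
    using weak[OF circle_gauss[OF that]] cos_power_tendsto_gauss_iff[OF a] by simp
  moreover have "circle_weak_conv \<mu> circle_haar \<longleftrightarrow>
      filterlim (\<lambda>n. real (K n) * (a n)\<^sup>2) at_top sequentially"
    using weak[OF circle_haar(1), of "\<lambda>l. if l = 0 then 1 else 0"] circle_haar(2)
      cos_power_tendsto_haar_iff[OF a, of K]
    by simp
  ultimately show ?thesis
    unfolding \<mu>_def a_def by (intro conjI allI impI)
qed

end
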